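(* Let $c$ be an even positive integer and $n\ge 1$. Then $$\sum_{\pi \in G_{c,n}} (-1)^{L(\pi)} q^{fmaj(\pi)}=[c]_{-q}\,[2c]_q\,[3c]_{-q}\,[4c]_{q}\cdots [nc]_{(-1)^{n}q}=\prod_{i=1}^{n}[ci]_{(-1)^i q}.$$
   Context: For positive integers $c,n$, the group $G_{c,n}$ of colored permutations consists of all words $\pi=\pi_1^{[t_1]}\pi_2^{[t_2]}\cdots\pi_n^{[t_n]}$ where $\pi_1\pi_2\cdots\pi_n$ is a permutation of $[n]=\{1,\dots,n\}$ (called $|\pi|$) and each color $t_i\in\{0,1,\dots,c-1\}$. The color number is $col(\pi)=\sum_i t_i$. For a permutation $\sigma$, $inv(\sigma)=|\{(i,j): i<j,\ \sigma_i>\sigma_j\}|$. The length of $\pi$ is $$L(\pi)=col(\pi)+c\cdot\sum_{j:\,t_j\neq 0}|\{i: i<j,\ \pi_i<\pi_j\}|+inv(|\pi|).$$ Order the colored letters by the total order $1^{[c-1]}<\cdots<n^{[c-1]}<\cdots<1^{[2]}<\cdots<n^{[2]}<1^{[1]}<\cdots<n^{[1]}<1<\cdots<n$ (letters of color $0$ written without superscript). Let $Des_c(\pi)=\{i\in[n-1]: \pi_i^{[t_i]}>\pi_{i+1}^{[t_{i+1}]}\}$ in this order, $maj(\pi)=\sum_{i\in Des_c(\pi)} i$, and the flag major index $fmaj(\pi)=c\cdot maj(\pi)+col(\pi)$. For a positive integer $m$ and indeterminate $x$, $[m]_x=\frac{1-x^m}{1-x}=1+x+\cdots+x^{m-1}$.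 *)

theory Defs
  imports "HOL-Computational_Algebra.Polynomial"
begin

text \<open>A colored letter \<open>a\<^sup>[\<^sup>t\<^sup>]\<close> is the pair \<open>(a, t)\<close>, and a colored permutation is the word
  of its colored letters.  List positions are counted from \<open>0\<close>, so the \<open>i\<close>-th letter of \<open>w\<close>
  is \<open>w ! (i - 1)\<close>.\<close>

type_synonym colored_word = "(nat \<times> nat) list"

definition colored_perms :: "nat \<Rightarrow> nat \<Rightarrow> colored_word set" where
  "colored_perms c n =
     {w. length w = n \<and> distinct (map fst w) \<and> set (map fst w) = {1..n} \<and>
         (\<forall>t \<in> set (map snd w). t < c)}"

definition col :: "colored_word \<Rightarrow> nat" where
  "col w = sum_list (map snd w)"

definition inv_num :: "nat list \<Rightarrow> nat" where
  "inv_num s = card {(i, j). i < j \<and> j < length s \<and> s ! i > s ! j}"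

definition clength :: "nat \<Rightarrow> colored_word \<Rightarrow> nat" where
  "clength c w =
     col w
     + c * (\<Sum>j | j < length w \<and> snd (w ! j) \<noteq> 0. card {i. i < j \<and> fst (w ! i) < fst (w ! j)})
     + inv_num (map fst w)"

text \<open>Letters of larger color are smaller.\<close>

definition letter_less :: "nat \<times> nat \<Rightarrow> nat \<times> nat \<Rightarrow> bool" where
  "letter_less x y \<longleftrightarrow> snd x > snd y \<or> (snd x = snd y \<and> fst x < fst y)"

text \<open>Descent positions are counted from \<open>1\<close>, which matters for the major index.\<close>

definition Des :: "colored_word \<Rightarrow> nat set" where
  "Des w = {i. 1 \<le> i \<and> i < length w \<and> letter_less (w ! i) (w ! (i - 1))}"

definition maj :: "colored_word \<Rightarrow> nat" where
  "maj w = \<Sum> (Des w)"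

definition fmaj :: "nat \<Rightarrow> colored_word \<Rightarrow> nat" where
  "fmaj c w = c * maj w + col w"

definition qint :: "nat \<Rightarrow> 'a::comm_ring_1 \<Rightarrow> 'a" where
  "qint m x = (\<Sum>k<m. x ^ k)"

lemma qint_closed_form: "(1 - x) * qint m x = 1 - x ^ m"
  unfolding qint_def by (rule one_diff_power_eq[symmetric])

lemma finite_colored_perms: "finite (colored_perms c n)"
proof (rule finite_subset)
  show "colored_perms c n \<subseteq> {w. set w \<subseteq> {1..n} \<times> {..<c} \<and> length w = n}"
  proof
    fix w assume w: "w \<in> colored_perms c n"
    have "x \<in> {1..n} \<times> {..<c}" if "x \<in> set w" for x
    proof -
      have "fst x \<in> set (map fst w)" "snd x \<in> set (map snd w)" using that by auto
      then have "fst x \<in> {1..n}" "snd x < c"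
        using w unfolding colored_perms_def by blast+
      then show ?thesis by (cases x) simp
    qed
    then show "w \<in> {w. set w \<subseteq> {1..n} \<times> {..<c} \<and> length w = n}"
      using w by (auto simp: colored_perms_def)
  qed
  show "finite {w. set w \<subseteq> {1..n} \<times> {..<c} \<and> length w = n}"
    by (rule finite_lists_length_eq) simp
qed

end

theory Submission
  imports Defs
begin

text \<open>
  Since \<open>c\<close> is even, the sign of \<open>w\<close> is \<open>(-1)\<close> to the power \<open>inv |w| + fmaj w\<close>, so with \<open>x = -q\<close> the
  sum is that of \<open>(-1)^(inv |w|) * x^(fmaj w)\<close>.  Let all letters of a word move one step down the
  total order, the least letter becoming the greatest.  This permutes the colored permutations,
  raises \<open>fmaj\<close> by one as long as the last letter is not the least one, and composes \<open>|w|\<close> with an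
  \<open>n\<close>-cycle, which has sign \<open>(-1)^(n-1)\<close>.  The words ending in the greatest letter contribute the
  sum for \<open>n - 1\<close>, and the \<open>cn\<close> shifts of this class exhaust all words; this gives the factor
  \<open>[cn]\<close> at \<open>(-1)^(n-1) * x\<close>.
\<close>

section \<open>The total order on letters and its cyclic shift\<close>

text \<open>The number of letters above \<open>x\<close> in the total order.\<close>

definition depth :: "nat \<Rightarrow> nat \<times> nat \<Rightarrow> nat" where
  "depth n x = snd x * n + (n - fst x)"

text \<open>Directly below value 1 of color \<open>t\<close> comes value \<open>n\<close> of color
  \<open>t + 1\<close>. From the last color the wrap to color 0 lands on the greatest
  letter.\<close>

definition shift_letter :: "nat \<Rightarrow> nat \<Rightarrow> nat \<times> nat \<Rightarrow> nat \<times> nat" where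
  "shift_letter c n x =
     (if fst x = 1 then (n, if Suc (snd x) < c then Suc (snd x) else 0) else (fst x - 1, snd x))"

text \<open>By counting, \<open>n\<close> distinct values inside \<open>{1..n}\<close> fill it, so
  membership becomes a condition on single letters plus distinctness.\<close>

lemma colored_perms_iff:
  "w \<in> colored_perms c n \<longleftrightarrow>
     length w = n \<and> distinct (map fst w) \<and> set w \<subseteq> {1..n} \<times> {..<c}"
proof
  assume w: "w \<in> colored_perms c n"
  have "x \<in> {1..n} \<times> {..<c}" if "x \<in> set w" for x
  proof -
    have "fst x \<in> set (map fst w)" "snd x \<in> set (map snd w)" using that by auto
    then have "fst x \<in> {1..n}" "snd x < c"
      using w unfolding colored_perms_def by blast+
    then show ?thesis by (cases x) simp
  qed
  then show "length w = n \<and> distinct (map fst w) \<and> set w \<subseteq> {1..n} \<times> {..<c}"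
    using w by (auto simp: colored_perms_def)
next
  assume w: "length w = n \<and> distinct (map fst w) \<and> set w \<subseteq> {1..n} \<times> {..<c}"
  then have "set (map fst w) \<subseteq> {1..n}" by fastforce
  moreover have "card (set (map fst w)) = n"
    using w distinct_card[of "map fst w"] by simp
  ultimately have "set (map fst w) = {1..n}"
    by (intro card_subset_eq) auto
  then show "w \<in> colored_perms c n"
    using w by (fastforce simp: colored_perms_def)
qed

lemma depth_less:
  assumes "x \<in> {1..n} \<times> {..<c}"
  shows "depth n x < c * n"
proof -
  obtain a t where x: "x = (a, t)" by (cases x)
  have "Suc t * n \<le> c * n" using assms x by (intro mult_right_mono) auto
  then show ?thesis using assms x by (auto simp: depth_def)
qed

text \<open>The offset \<open>n - fst x\<close> stays below \<open>n\<close>, so depth compares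
  colors first and values second; it grows downwards, which reverses the inequality.\<close>

lemma letter_less_iff_depth:
  assumes "x \<in> {1..n} \<times> {..<c}" "y \<in> {1..n} \<times> {..<c}"
  shows "letter_less x y \<longleftrightarrow> depth n y < depth n x"
proof -
  obtain a s b t where xy: "x = (a, s)" "y = (b, t)" by (cases x, cases y)
  have ab: "1 \<le> a" "a \<le> n" "1 \<le> b" "b \<le> n" using assms xy by auto
  consider "s < t" | "s = t" | "t < s" by linarith
  then show ?thesis
  proof cases
    case 1
    then have "Suc s * n \<le> t * n" by (intro mult_right_mono) auto
    then show ?thesis using 1 ab xy by (auto simp: depth_def letter_less_def)
  next
    case 2
    then show ?thesis using ab xy by (auto simp: depth_def letter_less_def)
  next
    case 3
    then have "Suc t * n \<le> s * n" by (intro mult_right_mono) auto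
    then show ?thesis using 3 ab xy by (auto simp: depth_def letter_less_def)
  qed
qed

text \<open>Crossing from value 1 to value \<open>n\<close> of the next color replaces offset
  \<open>n - 1\<close> by 0 and adds a block of \<open>n\<close>, again a net gain of one.\<close>

lemma depth_shift_letter:
  assumes "x \<in> {1..n} \<times> {..<c}"
  shows "depth n (shift_letter c n x) = (if x = (1, c - 1) then 0 else Suc (depth n x))"
  using assms by (cases x) (auto simp: depth_def shift_letter_def)

lemma depth_eq_max_iff:
  assumes "x \<in> {1..n} \<times> {..<c}"
  shows "Suc (depth n x) = c * n \<longleftrightarrow> x = (1, c - 1)"
proof
  assume *: "Suc (depth n x) = c * n"
  obtain a t where x: "x = (a, t)" by (cases x)
  have "t = c - 1"
  proof (rule ccontr)
    assume "t \<noteq> c - 1"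
    \<comment> \<open>Below color \<open>t\<close> there is another whole color, so the depth cannot
      be maximal.\<close>
    then have "Suc (Suc t) * n \<le> c * n" using assms x by (intro mult_right_mono) auto
    then show False using * assms x by (auto simp: depth_def)
  qed
  moreover have "c * n = (c - 1) * n + n" using assms x by (cases c) auto
  ultimately show "x = (1, c - 1)" using * assms x by (auto simp: depth_def)
next
  assume x: "x = (1, c - 1)"
  have "c * n = (c - 1) * n + n" using assms x by (cases c) auto
  then show "Suc (depth n x) = c * n" using assms x by (auto simp: depth_def)
qed

lemma depth_eq_0_iff:
  assumes "x \<in> {1..n} \<times> {..<c}"
  shows "depth n x = 0 \<longleftrightarrow> x = (n, 0)"
  using assms by (cases x; cases "snd x") (auto simp: depth_def)

lemma shift_letter_in:
  assumes "x \<in> {1..n} \<times> {..<c}"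
  shows "shift_letter c n x \<in> {1..n} \<times> {..<c}"
  using assms by (cases x) (auto simp: shift_letter_def)

lemma inj_on_shift_letter: "inj_on (shift_letter c n) ({1..n} \<times> {..<c})"
  by (auto simp: inj_on_def shift_letter_def split: if_splits)

lemma fst_shift_letter:
  "fst (shift_letter c n x) = (if fst x = 1 then n else fst x - 1)"
  by (simp add: shift_letter_def)

section \<open>The shift of whole words and its effect on the statistics\<close>

lemma map_shift_letter_colored_perms:
  assumes "w \<in> colored_perms c n"
  shows "map (shift_letter c n) w \<in> colored_perms c n"
proof -
  have w: "length w = n" "distinct (map fst w)" "set w \<subseteq> {1..n} \<times> {..<c}"
    using assms by (auto simp: colored_perms_iff)
  have "inj_on (\<lambda>a. if a = 1 then n else a - 1) (fst ` set w)"
  proof (rule inj_on_subset)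
    show "inj_on (\<lambda>a. if a = 1 then n else a - 1) {1..n}"
      by (auto simp: inj_on_def)
    show "fst ` set w \<subseteq> {1..n}" using w(3) by fastforce
  qed
  then have "distinct (map (\<lambda>a. if a = 1 then n else a - 1) (map fst w))"
    using w(2) by (subst distinct_map) simp
  then have "distinct (map fst (map (shift_letter c n) w))"
    by (simp add: comp_def fst_shift_letter)
  moreover have "set (map (shift_letter c n) w) \<subseteq> {1..n} \<times> {..<c}"
    unfolding set_map using w(3) shift_letter_in by blast
  ultimately show ?thesis
    using w(1) by (simp add: colored_perms_iff)
qed

text \<open>Injectivity passes from letters to words, and an injective self-map of a finite set is
  onto.\<close>

lemma bij_betw_map_shift_letter:
  "bij_betw (map (shift_letter c n)) (colored_perms c n) (colored_perms c n)"
proof -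
  have "inj_on (map (shift_letter c n)) (colored_perms c n)"
  proof (rule inj_onI)
    fix v w assume "v \<in> colored_perms c n" "w \<in> colored_perms c n"
      and eq: "map (shift_letter c n) v = map (shift_letter c n) w"
    then have "set v \<union> set w \<subseteq> {1..n} \<times> {..<c}"
      by (auto simp: colored_perms_iff)
    then have "inj_on (shift_letter c n) (set v \<union> set w)"
      using inj_on_shift_letter inj_on_subset by blast
    then show "v = w" using eq by (metis inj_on_map_eq_map)
  qed
  moreover have "map (shift_letter c n) ` colored_perms c n \<subseteq> colored_perms c n"
    using map_shift_letter_colored_perms by blast
  ultimately show ?thesis
    using endo_inj_surj[OF finite_colored_perms] by (simp add: bij_betw_def)
qed

text \<open>Only the letter of value 1 can change its color, or its value relative to the others,
  under the shift; isolating its position reduces both statistics to a local change.\<close>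

lemma ex_index_of_1:
  assumes "w \<in> colored_perms c n" "n \<ge> 1"
  shows "\<exists>p<n. fst (w ! p) = 1 \<and> (\<forall>i<n. i \<noteq> p \<longrightarrow> fst (w ! i) \<noteq> 1)"
proof -
  have len: "length (map fst w) = n" and "distinct (map fst w)" "1 \<in> set (map fst w)"
    using assms by (auto simp: colored_perms_def)
  then obtain p where p: "p < n" "map fst w ! p = 1" by (metis in_set_conv_nth)
  then have "map fst w ! i \<noteq> 1" if "i < n" "i \<noteq> p" for i
    using that len \<open>distinct (map fst w)\<close> nth_eq_iff_index_eq by metis
  then show ?thesis using p len by auto
qed

lemma col_eq_sum: "col w = (\<Sum>i<length w. snd (w ! i))"
  unfolding col_def by (simp add: sum_list_sum_nth atLeast0LessThan)

text \<open>The old color is added on the left because a wrap lowers \<open>col\<close>, and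
  subtraction on naturals would truncate.\<close>

lemma col_map_shift_letter:
  assumes w: "w \<in> colored_perms c n" and p: "p < n" "fst (w ! p) = 1"
    "\<And>i. i < n \<Longrightarrow> i \<noteq> p \<Longrightarrow> fst (w ! i) \<noteq> 1"
  shows "col (map (shift_letter c n) w) + snd (w ! p)
    = col w + (if Suc (snd (w ! p)) < c then Suc (snd (w ! p)) else 0)"
proof -
  have len: "length w = n" using w by (simp add: colored_perms_iff)
  have "col w = snd (w ! p) + (\<Sum>i\<in>{..<n} - {p}. snd (w ! i))"
    unfolding col_eq_sum len using p by (intro sum.remove) auto
  moreover have "col (map (shift_letter c n) w) =
      snd (shift_letter c n (w ! p)) + (\<Sum>i\<in>{..<n} - {p}. snd (shift_letter c n (w ! i)))"
    unfolding col_eq_sum using p len by (simp add: sum.remove[of "{..<n}" p])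
  moreover have "(\<Sum>i\<in>{..<n} - {p}. snd (shift_letter c n (w ! i)))
      = (\<Sum>i\<in>{..<n} - {p}. snd (w ! i))"
    using p by (intro sum.cong) (auto simp: shift_letter_def)
  ultimately show ?thesis using p by (simp add: shift_letter_def)
qed

lemma finite_Des: "finite (Des w)"
  by (rule finite_subset[of _ "{..<length w}"]) (auto simp: Des_def)

text \<open>All comparisons survive the shift except those with the least letter, which becomes the
  greatest one: the descent just before it moves to the position just after it.\<close>

lemma fmaj_map_shift_letter:
  assumes w: "w \<in> colored_perms c n" and "n \<ge> 1" and last: "last w \<noteq> (1, c - 1)"
  shows "fmaj c (map (shift_letter c n) w) = Suc (fmaj c w)"
proof -
  let ?v = "map (shift_letter c n) w"
  have len: "length w = n" using w by (simp add: colored_perms_iff)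
  obtain p where p: "p < n" "fst (w ! p) = 1" "\<And>i. i < n \<Longrightarrow> i \<noteq> p \<Longrightarrow> fst (w ! i) \<noteq> 1"
    using ex_index_of_1[OF w \<open>n \<ge> 1\<close>] by blast
  note col = col_map_shift_letter[OF w p]
  have L: "w ! i \<in> {1..n} \<times> {..<c}" if "i < n" for i
    using w that unfolding colored_perms_iff by (metis nth_mem subsetD)
  then have c: "snd (w ! p) < c" using p(1) by (metis SigmaE lessThan_iff snd_conv)
  \<comment> \<open>Depth grows downwards, so a descent is a rise in depth.\<close>
  have Des_w: "i \<in> Des w \<longleftrightarrow> 1 \<le> i \<and> i < n \<and> depth n (w ! (i - 1)) < depth n (w ! i)" for i
    using len L[of i] L[of "i - 1"] letter_less_iff_depth[of "w ! i" n c "w ! (i - 1)"]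
    by (auto simp: Des_def)
  have Des_v: "i \<in> Des ?v \<longleftrightarrow> 1 \<le> i \<and> i < n \<and>
      depth n (shift_letter c n (w ! (i - 1))) < depth n (shift_letter c n (w ! i))" for i
    using len shift_letter_in[OF L[of i]] shift_letter_in[OF L[of "i - 1"]]
      letter_less_iff_depth[of "shift_letter c n (w ! i)" n c "shift_letter c n (w ! (i - 1))"]
    by (auto simp: Des_def)
  show ?thesis
  proof (cases "snd (w ! p) = c - 1")
    \<comment> \<open>The least letter does not occur in \<open>w\<close>. All depths rise by one,
      so descents are unchanged and only \<open>col\<close> grows, by one.\<close>
    case False
    then have ne: "w ! i \<noteq> (1, c - 1)" if "i < n" for i
      using p that by (metis fst_conv snd_conv)
    have "depth n (shift_letter c n (w ! i)) = Suc (depth n (w ! i))" if "i < n" for i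
      using depth_shift_letter[OF L[OF that]] ne[OF that] by simp
    then have "Des ?v = Des w"
      unfolding set_eq_iff Des_w Des_v by auto
    moreover have "Suc (snd (w ! p)) < c" using False c by linarith
    ultimately show ?thesis using col by (simp add: fmaj_def maj_def)
  next
    case True
    then have wp: "w ! p = (1, c - 1)" using p by (simp add: prod_eq_iff)
    have ne: "w ! i \<noteq> (1, c - 1)" if "i < n" "i \<noteq> p" for i
      using p that by (metis fst_conv)
    have "last w = w ! (n - 1)"
      using len \<open>n \<ge> 1\<close> by (metis last_conv_nth list.size(3) not_one_le_zero)
    \<comment> \<open>This is where the condition on the last letter enters: the least letter has a
      right neighbour.\<close>
    then have pn: "Suc p < n" using last wp p(1) by (metis Suc_lessI diff_Suc_1)
    \<comment> \<open>The least letter has strictly the greatest depth.\<close>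
    have top: "depth n (w ! i) < depth n (w ! p)" if "i < n" "i \<noteq> p" for i
    proof -
      have "Suc (depth n (w ! p)) = c * n" using depth_eq_max_iff[OF L[OF p(1)]] wp by simp
      moreover have "Suc (depth n (w ! i)) \<noteq> c * n"
        using depth_eq_max_iff[OF L] ne that by simp
      moreover have "depth n (w ! i) < c * n" using depth_less[OF L] that by simp
      ultimately show ?thesis by linarith
    qed
    have sh: "depth n (shift_letter c n (w ! i)) = (if i = p then 0 else Suc (depth n (w ! i)))"
      if "i < n" for i
      using depth_shift_letter[OF L[OF that]] ne[OF that] wp by auto
    \<comment> \<open>With list index \<open>p\<close>, the comparisons involving the least letter
      are those at descent positions \<open>p\<close> and \<open>Suc p\<close>; \<open>M\<close>
      collects the descents elsewhere.\<close>
    define M where "M = Des w - {p}"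
    have "finite M" by (simp add: M_def finite_Des)
    have "Suc p \<notin> Des w" using top[of "Suc p"] pn by (simp add: Des_w)
    then have M: "p \<notin> M" "Suc p \<notin> M" "0 \<notin> M" by (auto simp: M_def Des_def)
    have v: "Des ?v = insert (Suc p) M"
    proof (rule set_eqI)
      fix i
      consider "i = 0" | "i = p" "i > 0" | "i = Suc p" | "i > 0" "i \<noteq> p" "i \<noteq> Suc p" by blast
      then show "i \<in> Des ?v \<longleftrightarrow> i \<in> insert (Suc p) M"
      proof cases
        case 4
        then have "i - 1 \<noteq> p" by auto
        then show ?thesis using 4 by (auto simp: Des_v Des_w M_def sh)
      qed (use M pn in \<open>auto simp: Des_v sh\<close>)
    qed
    have "maj ?v = Suc p + \<Sum>M"
      unfolding maj_def v using \<open>finite M\<close> M by simp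
    \<comment> \<open>If the least letter comes first, no descent precedes it, and the term
      \<open>p\<close> is 0.\<close>
    moreover have "maj w = p + \<Sum>M"
    proof (cases "p = 0")
      case True
      then have "M = Des w" by (auto simp: M_def Des_def)
      then show ?thesis using True by (simp add: maj_def)
    next
      case False
      then have "p \<in> Des w" using top[of "p - 1"] p(1) by (simp add: Des_w)
      then show ?thesis unfolding maj_def M_def by (simp add: sum.remove finite_Des)
    qed
    \<comment> \<open>The gain of \<open>c\<close> from \<open>maj\<close> is offset by the loss of
      \<open>c - 1\<close> in \<open>col\<close> as the least letter turns to color 0, leaving
      one.\<close>
    ultimately have "c * maj ?v = c * maj w + c" by simp
    then show ?thesis using col True c by (simp add: fmaj_def)
  qed
qed

text \<open>Inversions avoiding index \<open>p\<close> of the value 1 persist. The \<open>p\<close>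
  pairs ending at \<open>p\<close> cease to be inversions, and the \<open>n - 1 - p\<close> pairs
  starting there become inversions.\<close>

lemma inv_num_map_shift_letter:
  assumes w: "w \<in> colored_perms c n" and "n \<ge> 1"
  shows "(-1 :: 'a::comm_ring_1) ^ inv_num (map fst (map (shift_letter c n) w))
    = (-1) ^ (n - 1) * (-1) ^ inv_num (map fst w)"
proof -
  let ?v = "map (shift_letter c n) w"
  have len: "length w = n" using w by (simp add: colored_perms_iff)
  obtain p where p: "p < n" "fst (w ! p) = 1" "\<And>i. i < n \<Longrightarrow> i \<noteq> p \<Longrightarrow> fst (w ! i) \<noteq> 1"
    using ex_index_of_1[OF w \<open>n \<ge> 1\<close>] by blast
  have L: "fst (w ! i) \<in> {1..n}" if "i < n" for i
    using w that unfolding colored_perms_iff by (metis nth_mem subsetD mem_Times_iff)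
  have gt: "1 < fst (w ! i)" if "i < n" "i \<noteq> p" for i
    using L[OF that(1)] p(3)[OF that] by auto
  define B where "B = {(i, j). i < j \<and> j < n \<and> i \<noteq> p \<and> j \<noteq> p \<and> fst (w ! i) > fst (w ! j)}"
  have fin: "finite B"
    by (rule finite_subset[of _ "{..<n} \<times> {..<n}"]) (auto simp: B_def)
  have "{(i, j). i < j \<and> j < length (map fst w) \<and> map fst w ! i > map fst w ! j}
      = B \<union> {..<p} \<times> {p}"
    using len p(1,2) gt L by (fastforce simp: B_def)
  moreover have "card (B \<union> {..<p} \<times> {p}) = card B + p"
    by (subst card_Un_disjoint[OF fin]) (auto simp: B_def)
  ultimately have 1: "inv_num (map fst w) = card B + p"
    by (simp add: inv_num_def)
  have v: "map fst ?v ! i = (if i = p then n else fst (w ! i) - 1)" if "i < n" for i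
    using that p len by (auto simp: fst_shift_letter)
  have "{(i, j). i < j \<and> j < length (map fst ?v) \<and> map fst ?v ! i > map fst ?v ! j}
      = B \<union> {p} \<times> {p<..<n}" (is "?I = ?J")
  proof (rule set_eqI, clarify)
    fix i j
    show "(i, j) \<in> ?I \<longleftrightarrow> (i, j) \<in> ?J"
    proof (cases "i < j \<and> j < n")
      case True
      then show ?thesis
        using v[of i] v[of j] gt[of i] gt[of j] L[of i] L[of j] p(1) len
        by (auto simp: B_def simp del: nth_map)
    qed (use len in \<open>auto simp: B_def\<close>)
  qed
  moreover have "card (B \<union> {p} \<times> {p<..<n}) = card B + (n - 1 - p)"
    by (subst card_Un_disjoint[OF fin]) (auto simp: B_def)
  ultimately have 2: "inv_num (map fst ?v) = card B + (n - 1 - p)"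
    by (simp add: inv_num_def)
  \<comment> \<open>The two exponents differ by \<open>2 * p\<close>.\<close>
  have "(-1 :: 'a) ^ (n - 1 - p) = (-1) ^ (n - 1 + p)"
    using p(1) by (simp add: minus_one_power_iff)
  then show ?thesis unfolding 1 2 by (simp add: power_add)
qed

section \<open>Words ending in the greatest letter\<close>

lemma letters_below_top:
  assumes "w \<in> colored_perms c n" "x \<in> set w"
  shows "fst x \<le> n"
  using assms by (auto simp: colored_perms_iff)

lemma colored_perms_last_top:
  assumes "c > 0"
  shows "bij_betw (\<lambda>w. w @ [(Suc n, 0)]) (colored_perms c n)
    {w \<in> colored_perms c (Suc n). last w = (Suc n, 0)}"
proof (rule bij_betw_byWitness[where f' = butlast])
  show "(\<lambda>w. w @ [(Suc n, 0)]) ` colored_perms c n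
      \<subseteq> {w \<in> colored_perms c (Suc n). last w = (Suc n, 0)}"
    using assms by (fastforce simp: colored_perms_iff)
  show "butlast ` {w \<in> colored_perms c (Suc n). last w = (Suc n, 0)} \<subseteq> colored_perms c n"
  proof clarify
    fix w assume w: "w \<in> colored_perms c (Suc n)" "last w = (Suc n, 0)"
    then have "w \<noteq> []" by (auto simp: colored_perms_iff)
    then obtain v where v: "w = v @ [(Suc n, 0)]" using w(2) by (metis append_butlast_last_id)
    \<comment> \<open>Distinctness of values keeps \<open>Suc n\<close> out of the remaining
      word.\<close>
    have "x \<in> {1..n} \<times> {..<c}" if "x \<in> set v" for x
    proof -
      have "x \<in> {1..Suc n} \<times> {..<c}" "fst x \<noteq> Suc n"
        using w(1) that unfolding v colored_perms_iff by (auto simp: image_iff)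
      then show ?thesis by (cases x) auto
    qed
    then show "butlast w \<in> colored_perms c n"
      using w(1) unfolding v colored_perms_iff by auto
  qed
  show "\<forall>w\<in>{w \<in> colored_perms c (Suc n). last w = (Suc n, 0)}. butlast w @ [(Suc n, 0)] = w"
  proof clarify
    fix w assume w: "w \<in> colored_perms c (Suc n)" "last w = (Suc n, 0)"
    then have "w \<noteq> []" by (auto simp: colored_perms_iff)
    then show "butlast w @ [(Suc n, 0)] = w" using w(2) by (metis append_butlast_last_id)
  qed
qed simp

lemma fmaj_append_top:
  assumes "w \<in> colored_perms c n"
  shows "fmaj c (w @ [(Suc n, 0)]) = fmaj c w"
proof -
  have "Des (w @ [(Suc n, 0)]) = Des w"
  proof (rule set_eqI)
    fix i
    \<comment> \<open>The junction \<open>i = length w\<close> is the only possible new descent, and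
      the appended letter has minimal color and larger value.\<close>
    have "\<not> letter_less (Suc n, 0) (w ! (i - 1))" if "1 \<le> i" "i = length w"
      using letters_below_top[OF assms, of "w ! (i - 1)"] that by (auto simp: letter_less_def)
    then show "i \<in> Des (w @ [(Suc n, 0)]) \<longleftrightarrow> i \<in> Des w"
      by (auto simp: Des_def nth_append less_Suc_eq)
  qed
  then show ?thesis by (simp add: fmaj_def maj_def col_def)
qed

lemma inv_num_append_top:
  assumes "w \<in> colored_perms c n"
  shows "inv_num (map fst (w @ [(Suc n, 0)])) = inv_num (map fst w)"
proof -
  have "fst (w ! i) \<le> n" if "i < length w" for i
    using letters_below_top[OF assms] that by simp
  then have "{(i, j). i < j \<and> j < length (map fst (w @ [(Suc n, 0)])) \<and>
        map fst (w @ [(Suc n, 0)]) ! i > map fst (w @ [(Suc n, 0)]) ! j}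
      = {(i, j). i < j \<and> j < length (map fst w) \<and> map fst w ! i > map fst w ! j}"
    by (fastforce simp: nth_append less_Suc_eq)
  then show ?thesis by (simp add: inv_num_def)
qed

section \<open>The signed generating function and its recursion in the word length\<close>

definition signed_fmaj_weight :: "nat \<Rightarrow> 'a::comm_ring_1 \<Rightarrow> colored_word \<Rightarrow> 'a" where
  "signed_fmaj_weight c x w = (-1) ^ inv_num (map fst w) * x ^ fmaj c w"

text \<open>The shift maps the class of depth \<open>k\<close> onto the class of depth
  \<open>Suc k\<close>; for words of length \<open>Suc n\<close> it multiplies each weight by
  \<open>(-1) ^ n * x\<close>. The class of depth 0 is a copy of the words of length
  \<open>n\<close>.\<close>

lemma sum_weight_last_depth:
  fixes x :: "'a::comm_ring_1"
  assumes "c > 0" "k < c * Suc n"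
  shows "(\<Sum>w | w \<in> colored_perms c (Suc n) \<and> depth (Suc n) (last w) = k. signed_fmaj_weight c x w)
    = ((-1) ^ n * x) ^ k * (\<Sum>w \<in> colored_perms c n. signed_fmaj_weight c x w)"
  using assms(2)
proof (induction k)
  have last_in: "last w \<in> {1..Suc n} \<times> {..<c}" "w \<noteq> []" if "w \<in> colored_perms c (Suc n)" for w
  proof -
    show "w \<noteq> []" using that by (auto simp: colored_perms_iff)
    then show "last w \<in> {1..Suc n} \<times> {..<c}"
      using that unfolding colored_perms_iff by (metis last_in_set subsetD)
  qed
  {
    case 0
    have "{w \<in> colored_perms c (Suc n). depth (Suc n) (last w) = 0}
        = {w \<in> colored_perms c (Suc n). last w = (Suc n, 0)}"
      using depth_eq_0_iff[OF last_in(1)] by auto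
    then have "(\<Sum>w | w \<in> colored_perms c (Suc n) \<and> depth (Suc n) (last w) = 0. signed_fmaj_weight c x w)
        = (\<Sum>w \<in> colored_perms c n. signed_fmaj_weight c x (w @ [(Suc n, 0)]))"
      by (simp add: sum.reindex_bij_betw[OF colored_perms_last_top[OF assms(1)], symmetric])
    also have "\<dots> = (\<Sum>w \<in> colored_perms c n. signed_fmaj_weight c x w)"
      unfolding signed_fmaj_weight_def
      by (intro sum.cong refl) (simp only: fmaj_append_top inv_num_append_top)
    finally show ?case by simp
  next
    case (Suc k)
    let ?A = "\<lambda>k. {w \<in> colored_perms c (Suc n). depth (Suc n) (last w) = k}"
    let ?S = "map (shift_letter c (Suc n))"
    have depth_last: "depth (Suc n) (last (?S w))
        = (if last w = (1, c - 1) then 0 else Suc (depth (Suc n) (last w)))"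
      if "w \<in> colored_perms c (Suc n)" for w
      using depth_shift_letter[OF last_in(1)[OF that]] last_in(2)[OF that] by (simp add: last_map)
    \<comment> \<open>\<open>Suc k\<close> is still below the number of letters, so depth
      \<open>k\<close> is not the maximum.\<close>
    have not_min: "last w \<noteq> (1, c - 1)" if "w \<in> ?A k" for w
      using depth_eq_max_iff[OF last_in(1)] that Suc.prems by fastforce
    have "?S ` ?A k = ?A (Suc k)"
    proof
      show "?S ` ?A k \<subseteq> ?A (Suc k)"
        using depth_last not_min map_shift_letter_colored_perms by auto
      show "?A (Suc k) \<subseteq> ?S ` ?A k"
      proof
        fix v assume v: "v \<in> ?A (Suc k)"
        then obtain w where "w \<in> colored_perms c (Suc n)" "v = ?S w"
          using bij_betw_map_shift_letter[of c "Suc n"] by (auto simp: bij_betw_def)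
        \<comment> \<open>The depth at the end of \<open>v\<close> is nonzero, so its last letter
          did not arise by the wrap.\<close>
        then show "v \<in> ?S ` ?A k" using v depth_last[of w] by (auto split: if_splits)
      qed
    qed
    moreover have "inj_on ?S (?A k)"
      using bij_betw_map_shift_letter[of c "Suc n"] by (auto simp: bij_betw_def intro: inj_on_subset)
    ultimately have "bij_betw ?S (?A k) (?A (Suc k))" by (simp add: bij_betw_def)
    then have "(\<Sum>w \<in> ?A (Suc k). signed_fmaj_weight c x w)
        = (\<Sum>w \<in> ?A k. signed_fmaj_weight c x (?S w))"
      by (rule sum.reindex_bij_betw[symmetric])
    also have "\<dots> = (\<Sum>w \<in> ?A k. ((-1) ^ n * x) * signed_fmaj_weight c x w)"
    proof (rule sum.cong[OF refl])
      fix w assume w: "w \<in> ?A k"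
      then have cp: "w \<in> colored_perms c (Suc n)" by simp
      show "signed_fmaj_weight c x (?S w) = ((-1) ^ n * x) * signed_fmaj_weight c x w"
        using inv_num_map_shift_letter[OF cp, where 'a = 'a]
          fmaj_map_shift_letter[OF cp _ not_min[OF w]]
        by (simp add: signed_fmaj_weight_def algebra_simps del: map_map)
    qed
    also have "\<dots> = ((-1) ^ n * x) * (\<Sum>w \<in> ?A k. signed_fmaj_weight c x w)"
      by (simp add: sum_distrib_left)
    finally show ?case using Suc by (simp add: algebra_simps)
  }
qed

text \<open>Summing the classes over all depths of the last letter gives a geometric sum, which is
  the factor for \<open>Suc n\<close>.\<close>

lemma sum_signed_fmaj_weight:
  fixes x :: "'a::comm_ring_1"
  assumes "c > 0"
  shows "(\<Sum>w \<in> colored_perms c n. signed_fmaj_weight c x w)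
    = (\<Prod>i=1..n. qint (c * i) ((-1) ^ (i - 1) * x))"
proof (induction n)
  case 0
  have "colored_perms c 0 = {[]}" by (auto simp: colored_perms_iff)
  moreover have "Des [] = {}" by (auto simp: Des_def)
  ultimately show ?case
    by (simp add: signed_fmaj_weight_def inv_num_def fmaj_def maj_def col_def)
next
  case (Suc n)
  let ?W = "signed_fmaj_weight c x"
  have "depth (Suc n) (last w) < c * Suc n" if "w \<in> colored_perms c (Suc n)" for w
  proof -
    have "w \<noteq> []" using that by (auto simp: colored_perms_iff)
    then have "last w \<in> {1..Suc n} \<times> {..<c}"
      using that unfolding colored_perms_iff by (metis last_in_set subsetD)
    then show ?thesis by (rule depth_less)
  qed
  then have "sum ?W (colored_perms c (Suc n))
      = (\<Sum>k<c * Suc n. \<Sum>w | w \<in> colored_perms c (Suc n) \<and> depth (Suc n) (last w) = k. ?W w)"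
    by (intro sum.group[symmetric] finite_colored_perms) auto
  also have "\<dots> = (\<Sum>k<c * Suc n. ((-1) ^ n * x) ^ k * sum ?W (colored_perms c n))"
    using sum_weight_last_depth[OF assms] by (intro sum.cong) auto
  also have "\<dots> = sum ?W (colored_perms c n) * qint (c * Suc n) ((-1) ^ n * x)"
    unfolding qint_def sum_distrib_right[symmetric] by (rule mult.commute)
  finally show ?case using Suc.IH by simp
qed

section \<open>Reduction of the length modulo 2\<close>

theorem theorem2p1:
  fixes c n :: nat and q :: "int poly"
  defines "q \<equiv> [:0, 1:]"
  assumes "even c" and "c > 0" and "n \<ge> 1"
  shows "(\<Sum>w \<in> colored_perms c n. (-1) ^ clength c w * q ^ fmaj c w)
         = (\<Prod>i=1..n. qint (c * i) ((-1) ^ i * q))"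
proof -
  have "(-1) ^ clength c w * q ^ fmaj c w = signed_fmaj_weight c (- q) w" for w
  proof -
    \<comment> \<open>Multiples of the even \<open>c\<close> drop out modulo 2: \<open>fmaj\<close>
      reduces to \<open>col\<close>, and \<open>clength\<close> to \<open>col\<close> plus the
      inversion number. The sign \<open>(-1) ^ fmaj c w\<close> then turns \<open>q\<close> into
      \<open>- q\<close>.\<close>
    have "(-1 :: int poly) ^ clength c w = (-1) ^ inv_num (map fst w) * (-1) ^ fmaj c w"
      unfolding power_add[symmetric] using \<open>even c\<close>
      by (simp add: minus_one_power_iff clength_def fmaj_def)
    then show ?thesis
      by (simp add: signed_fmaj_weight_def power_minus[of q] mult.assoc)
  qed
  then have "(\<Sum>w \<in> colored_perms c n. (-1) ^ clength c w * q ^ fmaj c w)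
      = (\<Prod>i=1..n. qint (c * i) ((-1) ^ (i - 1) * - q))"
    by (simp only: sum_signed_fmaj_weight[OF \<open>c > 0\<close>])
  also have "\<dots> = (\<Prod>i=1..n. qint (c * i) ((-1) ^ i * q))"
  proof (rule prod.cong[OF refl])
    fix i assume "i \<in> {1..n}"
    \<comment> \<open>Since \<open>i\<close> is at least 1, \<open>i - 1\<close> is a true
      predecessor and the sign of \<open>- q\<close> restores the exponent \<open>i\<close>.\<close>
    then obtain j where "i = Suc j" by (cases i) auto
    then show "qint (c * i) ((-1) ^ (i - 1) * - q) = qint (c * i) ((-1) ^ i * q)" by simp
  qed
  finally show ?thesis .
qed

end
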